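(* Let $(\mathcal S,\mathcal A,\mathcal T,\gamma,\lambda)$ be an entropy-regularized infinite-horizon discounted MDP environment with $\mathcal S,\mathcal A$ finite, $|\mathcal S|,|\mathcal A|\ge2$, $\gamma\in[0,1)$, $\lambda>0$, and let $\bar\pi:\mathcal S\to\mathcal P(\mathcal A)$ be an observed optimal policy with $\bar\pi(a|s)>0$ for all $(s,a)$. Fix $a_0\in\mathcal A$. There exists an action-independent reward $f:\mathcal S\to\mathbb R$ for which $\bar\pi$ is the entropy-regularized optimal policy if and only if the system of equations $$\lambda\,\Delta\log\bar\pi(a)=\gamma\,\Delta\mathbb T(a)\,\upsilon,\qquad\forall a\in\mathcal A,$$ admits a solution $\upsilon\in\mathbb R^{|\mathcal S|}$.
   Context: Write $\mathcal S=\{s_1,\dots,s_{|\mathcal S|}\}$. For $a\in\mathcal A$: $\log\bar\pi(a)\in\mathbb R^{|\mathcal S|}$ is the vector with entries $\log\bar\pi(a|s_i)$; $\mathbb T(a)$ is the $|\mathcal S|\times|\mathcal S|$ matrix with $[\mathbb T(a)]_{ij}=\mathcal T(s_j|s_i,a)$; $\Delta\log\bar\pi(a)=\log\bar\pi(a)-\log\bar\pi(a_0)$ and $\Delta\mathbb T(a)=\mathbb T(a)-\mathbb T(a_0)$. Entropy-regularized MDP with reward $f$: policies are maps $\pi:\mathcal S\to\mathcal P(\mathcal A)$ (probability distributions on $\mathcal A$); the optimal value is $V^*_\lambda(s)=\max_\pi\mathbb E^\pi_s\big[\sum_{t\ge0}\gamma^t(f(S_t,A_t)-\lambda\log\pi(A_t|S_t))\big]$,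 where $S_0=s$, $A_t\sim\pi(\cdot|S_t)$, $S_{t+1}\sim\mathcal T(\cdot|S_t,A_t)$. Standard facts: $V^*_\lambda(s)=\lambda\log\sum_a\exp(Q^*_\lambda(s,a)/\lambda)$ with $Q^*_\lambda(s,a)=f(s,a)+\gamma\sum_{s'}\mathcal T(s'|s,a)V^*_\lambda(s')$, and the entropy-regularized optimal policy is $\pi^*_\lambda(a|s)=\exp\big((Q^*_\lambda(s,a)-V^*_\lambda(s))/\lambda\big)$. A reward is action-independent if $f(s,a)=f(s)$ does not depend on $a$. *)

theory Defs
  imports "HOL-Probability.Probability"
begin

text \<open>
  Throughout, \<open>T s a\<close> is the law of the next state, \<open>\<pi> s\<close> the law of the action taken in state \<open>s\<close>.
\<close>

definition decide :: "('s \<Rightarrow> 'a pmf) \<Rightarrow> 's \<Rightarrow> ('s \<times> 'a) pmf" where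
  "decide \<pi> s = map_pmf (Pair s) (\<pi> s)"

text \<open>
  The law of \<open>(S\<^sub>n, A\<^sub>n)\<close> given \<open>S\<^sub>0 = s\<close> and the past \<open>\<omega> i = (S\<^sub>i, A\<^sub>i)\<close>, \<open>i < n\<close>.
\<close>

primrec trajectory_kernel ::
  "('s \<Rightarrow> 'a \<Rightarrow> 's pmf) \<Rightarrow> ('s \<Rightarrow> 'a pmf) \<Rightarrow> 's \<Rightarrow> nat \<Rightarrow> (nat \<Rightarrow> 's \<times> 'a) \<Rightarrow> ('s \<times> 'a) pmf"
where
  "trajectory_kernel T \<pi> s 0 \<omega> = decide \<pi> s"
| "trajectory_kernel T \<pi> s (Suc n) \<omega> = bind_pmf (T (fst (\<omega> n)) (snd (\<omega> n))) (decide \<pi>)"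

text \<open>
  The law of the process \<open>(S\<^sub>t, A\<^sub>t)\<^sub>t\<close> on infinite trajectories: the projective limit that the
  Ionescu-Tulcea theorem attaches to the kernels above.
\<close>

definition trajectory_measure ::
  "('s \<Rightarrow> 'a \<Rightarrow> 's pmf) \<Rightarrow> ('s \<Rightarrow> 'a pmf) \<Rightarrow> 's \<Rightarrow> (nat \<Rightarrow> 's \<times> 'a) measure"
where
  "trajectory_measure T \<pi> s =
     projective_family.lim UNIV
       (Ionescu_Tulcea.CI (\<lambda>n \<omega>. measure_pmf (trajectory_kernel T \<pi> s n \<omega>))
         (\<lambda>_. count_space UNIV))
       (\<lambda>_. count_space UNIV)"

lemma Ionescu_Tulcea_trajectory_kernel:
  fixes T :: "'s \<Rightarrow> 'a \<Rightarrow> 's pmf"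
  shows "Ionescu_Tulcea (\<lambda>n \<omega>. measure_pmf (trajectory_kernel T \<pi> s n \<omega>))
           (\<lambda>_. count_space UNIV)"
proof (rule Ionescu_Tulcea.intro)
  let ?M = "\<lambda>_::nat. count_space (UNIV :: ('s \<times> 'a) set)"
  show "(\<lambda>\<omega>. measure_pmf (trajectory_kernel T \<pi> s i \<omega>))
          \<in> measurable (PiM {0..<i} ?M) (subprob_algebra (?M i))" for i
  proof (cases i)
    case 0
    then show ?thesis
      by (simp add: measure_pmf_in_subprob_space space_subprob_algebra)
  next
    case (Suc n)
    have "(\<lambda>x. measure_pmf (bind_pmf (T (fst x) (snd x)) (decide \<pi>)))
            \<in> measurable (count_space UNIV) (subprob_algebra (?M i))"
      by (auto simp: space_subprob_algebra
               intro!: prob_space_imp_subprob_space prob_space_measure_pmf)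
    moreover have "(\<lambda>\<omega>. \<omega> n) \<in> measurable (PiM {0..<i} ?M) (count_space UNIV)"
      using Suc by (intro measurable_component_singleton) auto
    ultimately show ?thesis
      using Suc by (simp add: measurable_compose[where g = "\<lambda>x. measure_pmf
                      (bind_pmf (T (fst x) (snd x)) (decide \<pi>))"])
  qed
  show "prob_space (measure_pmf (trajectory_kernel T \<pi> s i \<omega>))" for i \<omega>
    by (rule prob_space_measure_pmf)
qed

text \<open>
  The entropy-regularized return of \<open>\<pi>\<close> from \<open>s\<close>. Pairs with \<open>\<pi>(a|s) = 0\<close>, where \<open>ln 0 = 0\<close>
  by convention, are almost surely never visited.
\<close>

definition entropy_value ::
  "('s \<Rightarrow> 'a \<Rightarrow> 's pmf) \<Rightarrow> real \<Rightarrow> real \<Rightarrow> ('s \<Rightarrow> 'a \<Rightarrow> real) \<Rightarrow> ('s \<Rightarrow> 'a pmf) \<Rightarrow> 's \<Rightarrow> real"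
where
  "entropy_value T \<gamma> lam r \<pi> s =
     (LINT \<omega> | trajectory_measure T \<pi> s.
        (\<Sum>t. \<gamma> ^ t * (r (fst (\<omega> t)) (snd (\<omega> t))
                      - lam * ln (pmf (\<pi> (fst (\<omega> t))) (snd (\<omega> t))))))"

text \<open>A policy is optimal if it attains the maximal value simultaneously from every state.\<close>

definition entropy_optimal ::
  "('s \<Rightarrow> 'a \<Rightarrow> 's pmf) \<Rightarrow> real \<Rightarrow> real \<Rightarrow> ('s \<Rightarrow> 'a \<Rightarrow> real) \<Rightarrow> ('s \<Rightarrow> 'a pmf) \<Rightarrow> bool"
where
  "entropy_optimal T \<gamma> lam r \<pi> \<longleftrightarrow>
     (\<forall>s \<pi>'. entropy_value T \<gamma> lam r \<pi>' s \<le> entropy_value T \<gamma> lam r \<pi> s)"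

definition log_policy :: "('s :: finite \<Rightarrow> 'a pmf) \<Rightarrow> 'a \<Rightarrow> real ^ 's" where
  "log_policy \<pi> a = (\<chi> i. ln (pmf (\<pi> i) a))"

definition transition_matrix :: "('s :: finite \<Rightarrow> 'a \<Rightarrow> 's pmf) \<Rightarrow> 'a \<Rightarrow> real ^ 's ^ 's" where
  "transition_matrix T a = (\<chi> i j. pmf (T i a) j)"

definition delta_log_policy :: "('s :: finite \<Rightarrow> 'a pmf) \<Rightarrow> 'a \<Rightarrow> 'a \<Rightarrow> real ^ 's" where
  "delta_log_policy \<pi> a\<^sub>0 a = log_policy \<pi> a - log_policy \<pi> a\<^sub>0"

definition delta_transition ::
  "('s :: finite \<Rightarrow> 'a \<Rightarrow> 's pmf) \<Rightarrow> 'a \<Rightarrow> 'a \<Rightarrow> real ^ 's ^ 's" where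
  "delta_transition T a\<^sub>0 a = transition_matrix T a - transition_matrix T a\<^sub>0"

end

theory Submission
  imports Defs
begin

text \<open>
  A fully supported policy \<open>\<pi>\<close> is optimal for a reward \<open>r\<close> iff some \<open>v\<close> satisfies the soft Bellman
  equation \<open>\<lambda> log \<pi>(a|s) = r(s,a) + \<gamma> (T(a) v)(s) - v(s)\<close>. Both directions rest on the performance
  difference identity: the value of any policy exceeds \<open>v\<close> by the expected discounted sum of its
  one-step Bellman residuals with respect to \<open>v\<close>. If \<open>v\<close> solves the equation, these residuals are
  negative relative entropies. Conversely, taking the value of an optimal \<open>\<pi>\<close> for \<open>v\<close>, the softmax
  policy of its Q-function would do strictly better unless it equals \<open>\<pi>\<close>, by Gibbs' inequality.
  For an action-independent reward, subtracting the equation at \<open>a\<^sub>0\<close> eliminates the reward; in the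
  other direction the equation at \<open>a\<^sub>0\<close> defines it.
\<close>

section \<open>One-time laws of the trajectory measure\<close>

primrec marginal ::
  "('s \<Rightarrow> 'a \<Rightarrow> 's pmf) \<Rightarrow> ('s \<Rightarrow> 'a pmf) \<Rightarrow> 's \<Rightarrow> nat \<Rightarrow> ('s \<times> 'a) pmf"
where
  "marginal T \<pi> s 0 = decide \<pi> s"
| "marginal T \<pi> s (Suc n) = bind_pmf (marginal T \<pi> s n) (\<lambda>x. bind_pmf (T (fst x) (snd x)) (decide \<pi>))"

context
  fixes T :: "'s \<Rightarrow> 'a \<Rightarrow> 's pmf" and \<pi> :: "'s \<Rightarrow> 'a pmf" and s :: 's
begin

interpretation IT: Ionescu_Tulcea "\<lambda>n \<omega>. measure_pmf (trajectory_kernel T \<pi> s n \<omega>)"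
  "\<lambda>_. count_space UNIV"
  by (rule Ionescu_Tulcea_trajectory_kernel)

text \<open>\<open>IT.C 0 (Suc n)\<close> extends a history drawn from \<open>IT.C 0 n\<close> by
  \<open>IT.eP n\<close>, which samples from the kernel and appends the result as coordinate
  \<open>n\<close>. Reading off that coordinate undoes the appending and leaves the bare
  kernel.\<close>

lemma distr_C_last:
  "distr (IT.C 0 (Suc n) (\<lambda>_. undefined)) (count_space UNIV) (\<lambda>\<omega>. \<omega> n)
     = IT.C 0 n (\<lambda>_. undefined) \<bind> (\<lambda>\<omega>. measure_pmf (trajectory_kernel T \<pi> s n \<omega>))"
proof -
  let ?M = "\<lambda>_. count_space UNIV"
  let ?C = "IT.C 0 n (\<lambda>_. undefined)"
  have u: "(\<lambda>_. undefined) \<in> space (PiM {0..<0::nat} ?M)" by (simp add: space_PiM)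
  have sC: "sets ?C = sets (PiM {0..<n} ?M)" using IT.sets_C[OF u, of n] by simp
  have spC: "space ?C = space (PiM {0..<n} ?M)" using IT.space_C[OF u, of n] by simp
  have ne: "space ?C \<noteq> {}" by (rule prob_space.not_empty[OF IT.prob_space_C[OF u]])
  have "distr (IT.C 0 (Suc n) (\<lambda>_. undefined)) (count_space UNIV) (\<lambda>\<omega>. \<omega> n)
    = distr (?C \<bind> IT.eP n) (count_space UNIV) (\<lambda>\<omega>. \<omega> n)" by simp
  also have "\<dots> = ?C \<bind> (\<lambda>\<omega>. distr (IT.eP n \<omega>) (count_space UNIV) (\<lambda>\<omega>. \<omega> n))"
  proof (rule distr_bind[OF _ ne])
    show "IT.eP n \<in> measurable ?C (subprob_algebra (PiM {0..<Suc n} ?M))"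
      unfolding measurable_cong_sets[OF sC refl] by (rule IT.measurable_eP)
    show "(\<lambda>\<omega>. \<omega> n) \<in> measurable (PiM {0..<Suc n} ?M) (count_space UNIV)"
      by (intro measurable_component_singleton) auto
  qed
  also have "\<dots> = ?C \<bind> (\<lambda>\<omega>. measure_pmf (trajectory_kernel T \<pi> s n \<omega>))"
  proof (rule bind_cong[OF refl])
    fix \<omega> assume "\<omega> \<in> space ?C"
    then have w: "\<omega> \<in> space (PiM {0..<n} ?M)" by (simp add: spC)
    \<comment> \<open>The history is \<open>undefined\<close> from \<open>n\<close> on, so its
      update at \<open>n\<close> lies in the extensional product over
      \<open>{0..<Suc n}\<close>.\<close>
    have "fun_upd \<omega> n \<in> measurable (measure_pmf (trajectory_kernel T \<pi> s n \<omega>)) (PiM {0..<Suc n} ?M)"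
      using w by (auto simp: space_PiM PiE_iff extensional_def)
    moreover have "(\<lambda>\<omega>. \<omega> n) \<in> measurable (PiM {0..<Suc n} ?M) (count_space UNIV)"
      by (intro measurable_component_singleton) auto
    ultimately show "distr (IT.eP n \<omega>) (count_space UNIV) (\<lambda>\<omega>. \<omega> n)
        = measure_pmf (trajectory_kernel T \<pi> s n \<omega>)"
      unfolding IT.eP_def by (simp add: distr_distr comp_def distr_id2)
  qed
  finally show ?thesis .
qed

text \<open>The projective limit has the prescribed finite-dimensional laws \<open>IT.CI\<close>. On
  the initial segment \<open>{0..<n}\<close> the bound \<open>IT.up_to\<close> is \<open>n\<close>
  itself, so \<open>IT.CI\<close> is \<open>IT.C\<close> without any further projection.\<close>

lemma distr_trajectory_measure_C:
  "distr (trajectory_measure T \<pi> s) (PiM {0..<n} (\<lambda>_. count_space UNIV)) (\<lambda>\<omega>. restrict \<omega> {0..<n})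
    = IT.C 0 n (\<lambda>_. undefined)"
proof -
  have "IT.up_to {0..<n} = n"
    by (intro antisym)
       (auto simp: IT.up_to_iff, metis IT.up_to_less atLeastLessThan_iff finite_atLeastLessThan
          leI le0 less_irrefl)
  then show ?thesis
    unfolding trajectory_measure_def
    using IT.distr_lim[of "{0..<n}"] IT.distr_C[of n n "\<lambda>_. undefined" 0]
    by (simp add: IT.CI_def space_PiM)
qed

lemma distr_trajectory_measure:
  "distr (trajectory_measure T \<pi> s) (count_space UNIV) (\<lambda>\<omega>. \<omega> n) = measure_pmf (marginal T \<pi> s n)"
proof -
  have "distr (trajectory_measure T \<pi> s) (count_space UNIV) (\<lambda>\<omega>. \<omega> n)
    = distr (IT.C 0 (Suc n) (\<lambda>_. undefined)) (count_space UNIV) (\<lambda>\<omega>. \<omega> n)"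
    unfolding distr_trajectory_measure_C[symmetric]
    by (subst distr_distr)
       (auto simp: comp_def trajectory_measure_def measurable_cong_sets[OF IT.PF.sets_lim refl]
         intro!: measurable_component_singleton measurable_restrict)
  also have "\<dots> = measure_pmf (marginal T \<pi> s n)"
  proof (induction n)
    case 0
    show ?case unfolding distr_C_last by (simp add: bind_return[where N="count_space UNIV"])
  next
    case (Suc n)
    let ?C = "IT.C 0 (Suc n) (\<lambda>_. undefined)"
    let ?K = "\<lambda>x. measure_pmf (bind_pmf (T (fst x) (snd x)) (decide \<pi>))"
    have u: "(\<lambda>_. undefined) \<in> space (PiM {0..<0::nat} (\<lambda>_. count_space UNIV))" by (simp add: space_PiM)
    have sC: "sets ?C = sets (PiM {0..<Suc n} (\<lambda>_. count_space UNIV))" using IT.sets_C[OF u, of "Suc n"] by simp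
    have ne: "space ?C \<noteq> {}" by (rule prob_space.not_empty[OF IT.prob_space_C[OF u]])
    \<comment> \<open>Markov property: the kernel at time \<open>Suc n\<close> looks at the history
      only through coordinate \<open>n\<close>, so the induction hypothesis on the law of that
      single coordinate is enough.\<close>
    have "?C \<bind> (\<lambda>\<omega>. ?K (\<omega> n)) = distr ?C (count_space UNIV) (\<lambda>\<omega>. \<omega> n) \<bind> ?K"
      by (rule bind_distr[symmetric, OF _ _ ne, where K="count_space UNIV"])
         (auto simp: measurable_cong_sets[OF sC refl] space_subprob_algebra
           intro!: measurable_component_singleton prob_space_imp_subprob_space prob_space_measure_pmf
           simp del: IT.C.simps)
    then show ?case unfolding distr_C_last[of "Suc n"] Suc by (simp add: measure_pmf_bind del: IT.C.simps)
  qed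
  finally show ?thesis .
qed

end

lemma trajectory_measure_measurable:
  "(\<lambda>\<omega>. \<omega> n) \<in> measurable (trajectory_measure T \<pi> s) (count_space UNIV)"
proof -
  interpret IT: Ionescu_Tulcea "\<lambda>n \<omega>. measure_pmf (trajectory_kernel T \<pi> s n \<omega>)"
    "\<lambda>_. count_space UNIV"
    by (rule Ionescu_Tulcea_trajectory_kernel)
  show ?thesis
    unfolding trajectory_measure_def
    by (simp add: measurable_cong_sets[OF IT.PF.sets_lim refl] measurable_component_singleton)
qed

section \<open>Expectations over finite types and discounted series\<close>

lemma expectation_finite:
  fixes f :: "'b::finite \<Rightarrow> real"
  shows "measure_pmf.expectation p f = (\<Sum>x\<in>UNIV. pmf p x * f x)"
  by (subst integral_measure_pmf[where A=UNIV]) auto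

lemma expectation_bind_finite:
  fixes f :: "'b::finite \<Rightarrow> real" and q :: "'c::finite \<Rightarrow> 'b pmf"
  shows "measure_pmf.expectation (bind_pmf p q) f
    = measure_pmf.expectation p (\<lambda>x. measure_pmf.expectation (q x) f)"
  by (subst pmf_expectation_bind[where A=UNIV]) (auto simp: expectation_finite[of p])

lemma abs_expectation_le:
  fixes f :: "'b::finite \<Rightarrow> real"
  shows "\<bar>measure_pmf.expectation p f\<bar> \<le> (\<Sum>x\<in>UNIV. \<bar>f x\<bar>)"
proof -
  have "\<bar>\<Sum>x\<in>UNIV. pmf p x * f x\<bar> \<le> (\<Sum>x\<in>UNIV. \<bar>pmf p x * f x\<bar>)"
    by (rule sum_abs)
  also have "\<dots> \<le> (\<Sum>x\<in>UNIV. \<bar>f x\<bar>)"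
    by (intro sum_mono) (simp add: abs_mult mult_left_le_one_le pmf_le_1)
  finally show ?thesis by (simp add: expectation_finite)
qed

lemma summable_discounted:
  fixes c :: "nat \<Rightarrow> real"
  assumes "0 \<le> \<gamma>" "\<gamma> < 1" "\<And>t. \<bar>c t\<bar> \<le> B"
  shows "summable (\<lambda>t. \<gamma> ^ t * c t)"
proof (rule summable_comparison_test')
  show "summable (\<lambda>t. \<gamma> ^ t * B)"
    using assms by (intro summable_mult2 summable_geometric) auto
  show "norm (\<gamma> ^ t * c t) \<le> \<gamma> ^ t * B" for t
    using assms by (auto simp: abs_mult intro!: mult_left_mono)
qed

lemma summable_discounted_expectation:
  fixes f :: "'b::finite \<Rightarrow> real"
  assumes "0 \<le> \<gamma>" "\<gamma> < 1"
  shows "summable (\<lambda>t. \<gamma> ^ t * measure_pmf.expectation (p t) f)"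
  using assms abs_expectation_le by (rule summable_discounted)

text \<open>\<open>h\<close> is bounded because its domain is finite, so the discounted series
  converges absolutely and may be exchanged with the integral. From here on only the finite laws
  \<open>marginal\<close> matter, not the measure on infinite trajectories.\<close>

lemma integral_trajectory_measure_discounted:
  fixes T :: "'s::finite \<Rightarrow> 'a::finite \<Rightarrow> 's pmf" and h :: "'s \<times> 'a \<Rightarrow> real"
  assumes "0 \<le> \<gamma>" "\<gamma> < 1"
  shows "(LINT \<omega> | trajectory_measure T \<pi> s. (\<Sum>t. \<gamma> ^ t * h (\<omega> t)))
    = (\<Sum>t. \<gamma> ^ t * measure_pmf.expectation (marginal T \<pi> s t) h)"
proof -
  let ?M = "trajectory_measure T \<pi> s"
  define B where "B = (\<Sum>x\<in>UNIV. \<bar>h x\<bar>)"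
  have hB: "\<bar>h x\<bar> \<le> B" for x
    unfolding B_def by (rule member_le_sum) auto
  have int: "integrable ?M (\<lambda>\<omega>. g (\<omega> t))"
    and E: "(LINT \<omega> | ?M. g (\<omega> t)) = measure_pmf.expectation (marginal T \<pi> s t) g"
    for t and g :: "'s \<times> 'a \<Rightarrow> real"
  proof -
    have g: "g \<in> borel_measurable (count_space UNIV)" by simp
    show "integrable ?M (\<lambda>\<omega>. g (\<omega> t))"
      by (subst integrable_distr_eq[OF trajectory_measure_measurable g, symmetric])
         (auto simp: distr_trajectory_measure intro: integrable_measure_pmf_finite)
    show "(LINT \<omega> | ?M. g (\<omega> t)) = measure_pmf.expectation (marginal T \<pi> s t) g"
      by (subst integral_distr[OF trajectory_measure_measurable g, symmetric])
         (simp add: distr_trajectory_measure)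
  qed
  have "(LINT \<omega> | ?M. (\<Sum>t. \<gamma> ^ t * h (\<omega> t))) = (\<Sum>t. LINT \<omega> | ?M. \<gamma> ^ t * h (\<omega> t))"
  proof (rule integral_suminf)
    show "integrable ?M (\<lambda>\<omega>. \<gamma> ^ t * h (\<omega> t))" for t
      using int by simp
    show "AE \<omega> in ?M. summable (\<lambda>t. norm (\<gamma> ^ t * h (\<omega> t)))"
    proof (rule AE_I2)
      fix \<omega> :: "nat \<Rightarrow> 's \<times> 'a"
      have "summable (\<lambda>t. \<gamma> ^ t * \<bar>h (\<omega> t)\<bar>)"
        using hB by (intro summable_discounted[OF assms, where B=B]) simp
      then show "summable (\<lambda>t. norm (\<gamma> ^ t * h (\<omega> t)))"
        using assms by (simp add: abs_mult)
    qed
    have "summable (\<lambda>t. \<gamma> ^ t * measure_pmf.expectation (marginal T \<pi> s t) (\<lambda>x. \<bar>h x\<bar>))"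
      using assms by (rule summable_discounted_expectation)
    then show "summable (\<lambda>t. LINT \<omega> | ?M. norm (\<gamma> ^ t * h (\<omega> t)))"
      using assms by (simp add: abs_mult E[of "\<lambda>x. \<bar>h x\<bar>"])
  qed
  then show ?thesis by (simp add: E)
qed

section \<open>One-step decompositions of the value of a policy\<close>

text \<open>\<open>marginal\<close> recurses on the last step. Associativity of
  \<open>bind_pmf\<close> moves the recursion to the first step, which is what conditioning on the
  first transition requires.\<close>

lemma marginal_Suc_shift:
  "marginal T \<pi> s (Suc n)
    = bind_pmf (decide \<pi> s) (\<lambda>x. bind_pmf (T (fst x) (snd x)) (\<lambda>s'. marginal T \<pi> s' n))"
  by (induction n) (simp_all add: bind_assoc_pmf)

text \<open>Every marginal ends with \<open>decide\<close>, which draws the action from the policy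
  at the current state. A case distinction on \<open>n\<close> therefore replaces an
  induction.\<close>

lemma expectation_marginal_average:
  fixes T :: "'s::finite \<Rightarrow> 'a::finite \<Rightarrow> 's pmf" and g :: "'s \<Rightarrow> 'a \<Rightarrow> real"
  shows "measure_pmf.expectation (marginal T \<pi> s n) (\<lambda>x. g (fst x) (snd x))
    = measure_pmf.expectation (marginal T \<pi> s n)
        (\<lambda>x. measure_pmf.expectation (\<pi> (fst x)) (g (fst x)))"
  by (cases n) (simp_all add: expectation_bind_finite decide_def)

lemma expectation_marginal_Suc_fst:
  fixes T :: "'s::finite \<Rightarrow> 'a::finite \<Rightarrow> 's pmf" and v :: "'s \<Rightarrow> real"
  shows "measure_pmf.expectation (marginal T \<pi> s (Suc n)) (\<lambda>x. v (fst x))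
    = measure_pmf.expectation (marginal T \<pi> s n)
        (\<lambda>x. measure_pmf.expectation (T (fst x) (snd x)) v)"
  by (simp add: expectation_bind_finite decide_def)

text \<open>The gain from following the policy for one step, entropy bonus included, and then
  receiving \<open>v\<close>, over receiving \<open>v\<close> at once. Here \<open>v\<close> is
  arbitrary and may be unrelated to the policy.\<close>

definition bellman_residual ::
  "('s \<Rightarrow> 'a \<Rightarrow> 's pmf) \<Rightarrow> real \<Rightarrow> real \<Rightarrow> ('s \<Rightarrow> 'a \<Rightarrow> real) \<Rightarrow> ('s \<Rightarrow> 'a pmf) \<Rightarrow>
    ('s \<Rightarrow> real) \<Rightarrow> 's \<Rightarrow> real"
where
  "bellman_residual T \<gamma> lam r \<pi> v s = measure_pmf.expectation (\<pi> s)
     (\<lambda>a. r s a + \<gamma> * measure_pmf.expectation (T s a) v - v s - lam * ln (pmf (\<pi> s) a))"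

text \<open>With \<open>c t\<close> the mean of \<open>v\<close> at time \<open>t\<close>, the mean
  residual at time \<open>t\<close> is the mean one-step payoff plus
  \<open>\<gamma> * c (Suc t) - c t\<close>. After discounting, the terms in \<open>c\<close>
  telescope to \<open>- c 0\<close>, which is \<open>- v s\<close>.\<close>

lemma performance_difference:
  fixes T :: "'s::finite \<Rightarrow> 'a::finite \<Rightarrow> 's pmf" and v :: "'s \<Rightarrow> real"
  assumes \<gamma>: "0 \<le> \<gamma>" "\<gamma> < 1"
  shows "entropy_value T \<gamma> lam r \<pi> s = v s + (\<Sum>t. \<gamma> ^ t *
    measure_pmf.expectation (marginal T \<pi> s t) (\<lambda>x. bellman_residual T \<gamma> lam r \<pi> v (fst x)))"
proof -
  let ?E = "\<lambda>t. measure_pmf.expectation (marginal T \<pi> s t)"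
  define h where "h s a = r s a - lam * ln (pmf (\<pi> s) a)" for s a
  define c where "c t = ?E t (\<lambda>x. v (fst x))" for t
  have I: "integrable (measure_pmf p) f" for p :: "('s \<times> 'a) pmf" and f :: "_ \<Rightarrow> real"
    by (rule integrable_measure_pmf_finite) simp
  have res: "?E t (\<lambda>x. bellman_residual T \<gamma> lam r \<pi> v (fst x))
      = ?E t (\<lambda>x. h (fst x) (snd x)) + \<gamma> * c (Suc t) - c t" for t
  proof -
    have "?E t (\<lambda>x. bellman_residual T \<gamma> lam r \<pi> v (fst x))
      = ?E t (\<lambda>x. h (fst x) (snd x) + \<gamma> * measure_pmf.expectation (T (fst x) (snd x)) v - v (fst x))"
      using expectation_marginal_average[where g="\<lambda>s a. h s a
        + \<gamma> * measure_pmf.expectation (T s a) v - v s", of T \<pi> s t]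
      by (simp add: bellman_residual_def h_def algebra_simps)
    also have "\<dots> = ?E t (\<lambda>x. h (fst x) (snd x)) + \<gamma> * c (Suc t) - c t"
      by (simp add: I c_def expectation_marginal_Suc_fst del: marginal.simps)
    finally show ?thesis .
  qed
  have sc: "summable (\<lambda>t. \<gamma> ^ t * c t)"
    unfolding c_def by (rule summable_discounted_expectation[OF \<gamma>])
  have sh: "summable (\<lambda>t. \<gamma> ^ t * ?E t (\<lambda>x. h (fst x) (snd x)))"
    by (rule summable_discounted_expectation[OF \<gamma>])
  have "c 0 = v s" by (simp add: c_def decide_def)
  \<comment> \<open>The upper end of the telescope vanishes because the terms of the summable
    discounted series of \<open>c\<close> tend to 0.\<close>
  then have tele: "(\<lambda>t. \<gamma> ^ Suc t * c (Suc t) - \<gamma> ^ t * c t) sums (0 - v s)"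
    using telescope_sums[OF summable_LIMSEQ_zero[OF sc]] by simp
  have "(\<lambda>t. \<gamma> ^ t * ?E t (\<lambda>x. bellman_residual T \<gamma> lam r \<pi> v (fst x)))
      sums ((\<Sum>t. \<gamma> ^ t * ?E t (\<lambda>x. h (fst x) (snd x))) + (0 - v s))"
    using sums_add[OF summable_sums[OF sh] tele] by (simp add: res algebra_simps)
  moreover have "entropy_value T \<gamma> lam r \<pi> s = (\<Sum>t. \<gamma> ^ t * ?E t (\<lambda>x. h (fst x) (snd x)))"
    unfolding entropy_value_def
    using integral_trajectory_measure_discounted[OF \<gamma>, of T \<pi> s "\<lambda>x. h (fst x) (snd x)"]
    by (simp add: h_def)
  ultimately show ?thesis by (simp add: sums_iff)
qed

text \<open>Split off the first term of the value series. By \<open>marginal_Suc_shift\<close> the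
  tail is \<open>\<gamma>\<close> times the mean of the value at the next state.\<close>

lemma entropy_value_bellman:
  fixes T :: "'s::finite \<Rightarrow> 'a::finite \<Rightarrow> 's pmf"
  assumes \<gamma>: "0 \<le> \<gamma>" "\<gamma> < 1"
  shows "bellman_residual T \<gamma> lam r \<pi> (entropy_value T \<gamma> lam r \<pi>) s = 0"
proof -
  define h where "h x = r (fst x) (snd x) - lam * ln (pmf (\<pi> (fst x)) (snd x))" for x
  define V where "V = entropy_value T \<gamma> lam r \<pi>"
  define e where "e s t = measure_pmf.expectation (marginal T \<pi> s t) h" for s t
  have V: "V s = (\<Sum>t. \<gamma> ^ t * e s t)" for s
    using integral_trajectory_measure_discounted[OF \<gamma>, of T \<pi> s h]
    by (simp add: h_def V_def e_def entropy_value_def)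
  have se: "summable (\<lambda>t. \<gamma> ^ t * e s t)" for s
    unfolding e_def by (rule summable_discounted_expectation[OF \<gamma>])
  \<comment> \<open>The mean is a finite sum over states, so it commutes with the convergent
    series.\<close>
  have swap: "(\<lambda>t. \<gamma> ^ t * measure_pmf.expectation p (\<lambda>s'. e s' t)) sums measure_pmf.expectation p V"
    for p
  proof -
    have "(\<lambda>t. \<Sum>s'\<in>UNIV. pmf p s' * (\<gamma> ^ t * e s' t)) sums (\<Sum>s'\<in>UNIV. pmf p s' * V s')"
      using se by (intro sums_sum sums_mult) (simp add: V summable_sums)
    then show ?thesis by (simp add: expectation_finite sum_distrib_left mult_ac)
  qed
  \<comment> \<open>The law of the successor of \<open>s\<close> when the action is drawn from the
    policy.\<close>
  define q where "q = bind_pmf (\<pi> s) (T s)"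
  have "e s (Suc t) = measure_pmf.expectation q (\<lambda>s'. e s' t)" for t
    unfolding e_def marginal_Suc_shift q_def
    by (simp add: decide_def map_pmf_def bind_assoc_pmf bind_return_pmf expectation_bind_finite)
  then have "(\<lambda>t. \<gamma> * (\<gamma> ^ t * e s (Suc t))) sums (\<gamma> * measure_pmf.expectation q V)"
    using sums_mult[OF swap] by simp
  then have "V s = e s 0 + \<gamma> * measure_pmf.expectation q V"
    unfolding V using suminf_split_head[OF se, of s] by (simp add: sums_iff mult.assoc)
  moreover have "bellman_residual T \<gamma> lam r \<pi> V s = e s 0 + \<gamma> * measure_pmf.expectation q V - V s"
    by (simp add: bellman_residual_def e_def h_def q_def decide_def expectation_bind_finite
      integrable_measure_pmf_finite)
  ultimately show ?thesis by (simp add: V_def)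
qed

section \<open>Relative entropy and softmax distributions\<close>

text \<open>This is \<open>ln x <= x - 1\<close>, with equality only at 1, applied to the ratio of
  the two masses and averaged under \<open>p\<close>. The inequality admits \<open>p\<close> without
  full support because it is applied to arbitrary competing policies.\<close>

lemma gibbs_inequality:
  fixes p q :: "'a::finite pmf"
  assumes q: "\<And>a. pmf q a > 0"
  shows "measure_pmf.expectation p (\<lambda>a. ln (pmf q a) - ln (pmf p a)) \<le> 0" (is "?E \<le> 0")
    and "(\<And>a. pmf p a > 0) \<Longrightarrow>
      measure_pmf.expectation p (\<lambda>a. ln (pmf q a) - ln (pmf p a)) = 0 \<Longrightarrow> p = q"
proof -
  \<comment> \<open>The pointwise slack. Both distributions have mass 1, so the slacks sum to
    \<open>- ?E\<close>; where \<open>p\<close> vanishes the slack is just the mass of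
    \<open>q\<close>.\<close>
  let ?gap = "\<lambda>a. pmf q a - pmf p a - pmf p a * (ln (pmf q a) - ln (pmf p a))"
  have gap: "?gap a \<ge> 0 \<and> (pmf p a > 0 \<longrightarrow> ?gap a = 0 \<longrightarrow> pmf p a = pmf q a)" for a
  proof (cases "pmf p a = 0")
    case False
    then have p: "pmf p a > 0" by (simp add: pmf_pos)
    define x where "x = pmf q a / pmf p a"
    have x: "x > 0" using p q by (simp add: x_def)
    have "ln x = ln (pmf q a) - ln (pmf p a)"
      using p q[of a] by (simp add: x_def ln_divide_pos)
    then have "?gap a = pmf p a * (x - 1 - ln x)"
      using p by (simp add: x_def right_diff_distrib)
    moreover have "ln x \<le> x - 1" using x by (rule ln_le_minus_one)
    moreover have "pmf p a = pmf q a" if "x - 1 - ln x = 0"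
    proof -
      have "x = 1" using x that by (intro ln_eq_minus_one) auto
      then show ?thesis using p by (simp add: x_def)
    qed
    ultimately show ?thesis using p by simp
  qed (use q[of a] in auto)
  have sum: "(\<Sum>a\<in>UNIV. ?gap a) = - ?E"
    by (simp add: sum_subtractf sum_pmf_eq_1 expectation_finite)
  show "?E \<le> 0" using sum_nonneg[of UNIV ?gap] gap by (simp add: sum)
  show "p = q" if "\<And>a. pmf p a > 0" "?E = 0"
  proof (rule pmf_eqI)
    fix a
    have "?gap a = 0"
      using sum_nonneg_eq_0_iff[of UNIV ?gap] gap sum that(2) by simp
    then show "pmf p a = pmf q a" using gap that by blast
  qed
qed

text \<open>Normalized exponentials of \<open>Q a / lam\<close>. The constant \<open>L\<close> is
  \<open>lam\<close> times the logarithm of the partition function, that is, the soft maximum of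
  \<open>Q\<close>.\<close>

lemma ex_softmax:
  fixes Q :: "'a::finite \<Rightarrow> real"
  assumes "lam > 0"
  obtains p L where "\<And>a. pmf p a > 0" "\<And>a. lam * ln (pmf p a) = Q a - L"
proof -
  define Z where "Z = (\<Sum>a\<in>UNIV. exp (Q a / lam))"
  have Z: "Z > 0" unfolding Z_def by (intro sum_pos) auto
  define w where "w a = exp (Q a / lam) / Z" for a
  have w: "w a > 0" for a using Z by (simp add: w_def)
  have "(\<Sum>a\<in>UNIV. w a) = 1" using Z by (simp add: w_def Z_def flip: sum_divide_distrib)
  then have "(\<integral>\<^sup>+a. ennreal (w a) \<partial>count_space UNIV) = 1"
    using w by (simp add: nn_integral_count_space_finite less_imp_le flip: ennreal_1)
  then have "pmf (embed_pmf w) a = w a" for a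
    using w by (intro pmf_embed_pmf) (auto intro: less_imp_le)
  moreover have "lam * ln (w a) = Q a - lam * ln Z" for a
    using Z assms by (simp add: w_def ln_div field_simps)
  ultimately show thesis
    using w by (intro that[of "embed_pmf w" "lam * ln Z"]) auto
qed

section \<open>Optimality as a soft Bellman equation\<close>

text \<open>Since the policy is given, the right-hand side is linear in \<open>r\<close> and
  \<open>v\<close>. Any solution \<open>v\<close> turns out to be the value of the policy.\<close>

lemma entropy_optimal_iff_soft_bellman:
  fixes T :: "'s::finite \<Rightarrow> 'a::finite \<Rightarrow> 's pmf"
  assumes \<gamma>: "0 \<le> \<gamma>" "\<gamma> < 1" and lam: "lam > 0" and full: "\<And>s a. pmf (\<pi> s) a > 0"
  shows "entropy_optimal T \<gamma> lam r \<pi> \<longleftrightarrow> (\<exists>v. \<forall>s a.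
    lam * ln (pmf (\<pi> s) a) = r s a + \<gamma> * measure_pmf.expectation (T s a) v - v s)"
proof
  assume opt: "entropy_optimal T \<gamma> lam r \<pi>"
  \<comment> \<open>\<open>V\<close> is only the value of the given policy, so the soft maximum
    \<open>L\<close> of its Q-function may still differ from it. The goal is
    \<open>L = V\<close>.\<close>
  define V where "V = entropy_value T \<gamma> lam r \<pi>"
  define Q where "Q s a = r s a + \<gamma> * measure_pmf.expectation (T s a) V" for s a
  have "\<forall>s. \<exists>p L. (\<forall>a. pmf p a > 0) \<and> (\<forall>a. lam * ln (pmf p a) = Q s a - L)"
    using ex_softmax[OF lam] by metis
  then obtain q L where q: "\<And>s a. pmf (q s) a > 0" "\<And>s a. lam * ln (pmf (q s) a) = Q s a - L s"
    by metis
  let ?E = "\<lambda>s t. measure_pmf.expectation (marginal T q s t)"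
  \<comment> \<open>The negative of the relative entropy of the policy with respect to the softmax
    policy \<open>q\<close>. As the residual of the policy at its own value is zero,
    \<open>L - V\<close> is \<open>lam\<close> times that relative entropy, hence
    nonnegative.\<close>
  define kl where "kl s = measure_pmf.expectation (\<pi> s) (\<lambda>a. ln (pmf (q s) a) - ln (pmf (\<pi> s) a))" for s
  have "bellman_residual T \<gamma> lam r \<pi> V s = L s - V s + lam * kl s" for s
  proof -
    have "bellman_residual T \<gamma> lam r \<pi> V s = measure_pmf.expectation (\<pi> s)
        (\<lambda>a. L s - V s + lam * (ln (pmf (q s) a) - ln (pmf (\<pi> s) a)))"
      unfolding bellman_residual_def by (simp add: q(2) right_diff_distrib Q_def algebra_simps)
    then show ?thesis by (simp add: kl_def integrable_measure_pmf_finite)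
  qed
  then have LV: "L s - V s = - (lam * kl s)" for s
    using entropy_value_bellman[OF \<gamma>, of T lam r \<pi> s] by (simp add: V_def)
  have kl: "kl s \<le> 0" for s unfolding kl_def using q(1) by (rule gibbs_inequality)
  then have gap: "L s - V s \<ge> 0" for s using lam by (simp add: LV mult_nonneg_nonpos)
  \<comment> \<open>For \<open>q\<close> itself the entropy term cancels the Q-function up to
    \<open>L\<close>, so the one-step gain is the same for every action.\<close>
  have res_q: "bellman_residual T \<gamma> lam r q V s = L s - V s" for s
  proof -
    have "bellman_residual T \<gamma> lam r q V s = measure_pmf.expectation (q s) (\<lambda>a. L s - V s)"
      unfolding bellman_residual_def by (simp add: q(2)) (simp add: Q_def)
    then show ?thesis by simp
  qed
  have LV0: "L s - V s = 0" for s
  proof -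
    let ?f = "\<lambda>t. \<gamma> ^ t * ?E s t (\<lambda>x. L (fst x) - V (fst x))"
    have "?f t \<ge> 0" for t
      using \<gamma> gap by (simp add: integral_nonneg_AE del: Bochner_Integration.integral_diff)
    \<comment> \<open>All terms are nonnegative, so the series dominates its first term, which is
      the gap at \<open>s\<close>. Thus \<open>q\<close> beats the policy by at least that gap, and
      optimality forces the gap to be 0.\<close>
    then have "sum ?f {0} \<le> suminf ?f"
      by (intro sum_le_suminf summable_discounted_expectation[OF \<gamma>]) auto
    then have "?f 0 \<le> suminf ?f" by simp
    moreover have "?f 0 = L s - V s"
      by (simp add: decide_def del: Bochner_Integration.integral_diff)
    moreover have "entropy_value T \<gamma> lam r q s = V s + suminf ?f"
      using performance_difference[OF \<gamma>, of T lam r q s V] by (simp add: res_q)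
    moreover have "entropy_value T \<gamma> lam r q s \<le> V s"
      using opt by (simp add: entropy_optimal_def V_def)
    ultimately show ?thesis using gap[of s] by linarith
  qed
  have "\<pi> s = q s" for s
    \<comment> \<open>A zero gap means zero relative entropy, the equality case of Gibbs.\<close>
    using gibbs_inequality(2)[OF q(1) full] LV[of s] LV0[of s] lam by (simp add: kl_def)
  then have "lam * ln (pmf (\<pi> s) a) = r s a + \<gamma> * measure_pmf.expectation (T s a) V - V s" for s a
    using q(2)[of s a] LV0[of s] by (simp add: Q_def)
  then show "\<exists>v. \<forall>s a. lam * ln (pmf (\<pi> s) a) = r s a + \<gamma> * measure_pmf.expectation (T s a) v - v s"
    by blast
next
  assume "\<exists>v. \<forall>s a. lam * ln (pmf (\<pi> s) a) = r s a + \<gamma> * measure_pmf.expectation (T s a) v - v s"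
  then obtain v where v: "\<And>s a. r s a + \<gamma> * measure_pmf.expectation (T s a) v - v s = lam * ln (pmf (\<pi> s) a)"
    by metis
  \<comment> \<open>By the soft Bellman equation, each competitor's residual is minus
    \<open>lam\<close> times its relative entropy with respect to the given policy. So
    \<open>v\<close> bounds every value, and the given policy, with zero residual, attains
    it.\<close>
  have res: "bellman_residual T \<gamma> lam r \<pi>' v s
      = lam * measure_pmf.expectation (\<pi>' s) (\<lambda>a. ln (pmf (\<pi> s) a) - ln (pmf (\<pi>' s) a))" for \<pi>' s
    by (simp add: bellman_residual_def v flip: right_diff_distrib)
  have le: "entropy_value T \<gamma> lam r \<pi>' s \<le> v s" for \<pi>' s
  proof -
    have "bellman_residual T \<gamma> lam r \<pi>' v s \<le> 0" for s
      using gibbs_inequality(1)[OF full] lam by (simp add: res mult_nonneg_nonpos)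
    then have "measure_pmf.expectation (marginal T \<pi>' s t)
        (\<lambda>x. bellman_residual T \<gamma> lam r \<pi>' v (fst x)) \<le> 0" for t
      by (simp add: expectation_finite sum_nonpos mult_nonneg_nonpos)
    then have "(\<Sum>t. \<gamma> ^ t * measure_pmf.expectation (marginal T \<pi>' s t)
        (\<lambda>x. bellman_residual T \<gamma> lam r \<pi>' v (fst x))) \<le> 0"
      using \<gamma> by (intro suminf_le_const[OF summable_discounted_expectation] sum_nonpos)
        (auto simp: mult_nonneg_nonpos)
    then show ?thesis using performance_difference[OF \<gamma>, of T lam r \<pi>' s v] by simp
  qed
  moreover have "entropy_value T \<gamma> lam r \<pi> s = v s" for s
    using performance_difference[OF \<gamma>, of T lam r \<pi> s v] by (simp add: res)
  ultimately show "entropy_optimal T \<gamma> lam r \<pi>"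
    by (simp add: entropy_optimal_def)
qed

section \<open>Eliminating the action-independent reward\<close>

lemma delta_equation_nth:
  fixes T :: "'s::finite \<Rightarrow> 'a::finite \<Rightarrow> 's pmf" and \<upsilon> :: "real ^ 's"
  shows "lam *\<^sub>R delta_log_policy \<pi> a\<^sub>0 a = \<gamma> *\<^sub>R (delta_transition T a\<^sub>0 a *v \<upsilon>) \<longleftrightarrow>
    (\<forall>s. lam * ln (pmf (\<pi> s) a) - lam * ln (pmf (\<pi> s) a\<^sub>0)
      = \<gamma> * measure_pmf.expectation (T s a) (($) \<upsilon>) - \<gamma> * measure_pmf.expectation (T s a\<^sub>0) (($) \<upsilon>))"
  by (simp add: vec_eq_iff delta_log_policy_def log_policy_def delta_transition_def
      transition_matrix_def matrix_vector_mult_def expectation_finite left_diff_distrib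
      right_diff_distrib sum_subtractf)

theorem theorem5:
  fixes T :: "'s :: finite \<Rightarrow> 'a :: finite \<Rightarrow> 's pmf"
    and \<gamma> lam :: real
    and \<pi> :: "'s \<Rightarrow> 'a pmf"
    and a\<^sub>0 :: 'a
  assumes "CARD('s) \<ge> 2" and "CARD('a) \<ge> 2"
    and "0 \<le> \<gamma>" and "\<gamma> < 1" and "lam > 0"
    and observed_optimal: "\<exists>r :: 's \<Rightarrow> 'a \<Rightarrow> real. entropy_optimal T \<gamma> lam r \<pi>"
    and full_support: "\<And>s a. pmf (\<pi> s) a > 0"
  shows "(\<exists>f :: 's \<Rightarrow> real. entropy_optimal T \<gamma> lam (\<lambda>s a. f s) \<pi>)
    \<longleftrightarrow> (\<exists>\<upsilon> :: real ^ 's. \<forall>a.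
          lam *\<^sub>R delta_log_policy \<pi> a\<^sub>0 a = \<gamma> *\<^sub>R (delta_transition T a\<^sub>0 a *v \<upsilon>))"
  unfolding entropy_optimal_iff_soft_bellman[OF assms(3-5) full_support]
proof
  assume "\<exists>(f :: 's \<Rightarrow> real) v. \<forall>s a. lam * ln (pmf (\<pi> s) a)
      = f s + \<gamma> * measure_pmf.expectation (T s a) v - v s"
  then obtain f v where v: "\<And>s a. lam * ln (pmf (\<pi> s) a)
      = f s + \<gamma> * measure_pmf.expectation (T s a) v - v s"
    by blast
  have "(($) (\<chi> s. v s)) = v" by auto
  then show "\<exists>\<upsilon> :: real ^ 's. \<forall>a.
      lam *\<^sub>R delta_log_policy \<pi> a\<^sub>0 a = \<gamma> *\<^sub>R (delta_transition T a\<^sub>0 a *v \<upsilon>)"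
    by (intro exI[of _ "\<chi> s. v s"]) (simp add: delta_equation_nth v)
next
  assume "\<exists>\<upsilon> :: real ^ 's. \<forall>a.
      lam *\<^sub>R delta_log_policy \<pi> a\<^sub>0 a = \<gamma> *\<^sub>R (delta_transition T a\<^sub>0 a *v \<upsilon>)"
  then obtain \<upsilon> :: "real ^ 's" where \<upsilon>: "\<And>s a.
      lam * ln (pmf (\<pi> s) a) - lam * ln (pmf (\<pi> s) a\<^sub>0)
      = \<gamma> * measure_pmf.expectation (T s a) (($) \<upsilon>) - \<gamma> * measure_pmf.expectation (T s a\<^sub>0) (($) \<upsilon>)"
    unfolding delta_equation_nth by blast
  \<comment> \<open>The only reward for which the soft Bellman equation holds at the reference
    action with \<open>\<upsilon>\<close> as value. The difference equations carry it over to all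
    other actions.\<close>
  define f where
    "f s = lam * ln (pmf (\<pi> s) a\<^sub>0) - \<gamma> * measure_pmf.expectation (T s a\<^sub>0) (($) \<upsilon>) + \<upsilon> $ s" for s
  have "lam * ln (pmf (\<pi> s) a) = f s + \<gamma> * measure_pmf.expectation (T s a) (($) \<upsilon>) - \<upsilon> $ s" for s a
    using \<upsilon>[of s a] by (simp add: f_def)
  then show "\<exists>(f :: 's \<Rightarrow> real) v. \<forall>s a. lam * ln (pmf (\<pi> s) a)
      = f s + \<gamma> * measure_pmf.expectation (T s a) v - v s"
    by blast
qed

end
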